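(* Let $\mathcal{C}$ be a $d$-clutter on $[n]$ such that $I(\overline{\mathcal{C}})$ is squarefree stable. Then $\mathcal{C}$ is chordal.
   Context: Let $[n]=\{1,\ldots,n\}$ and let $d\ge 0$ be an integer. A $d$-clutter on $[n]$ is a (possibly empty) family $\mathcal{C}$ of $(d+1)$-subsets of $[n]$, called circuits. $\overline{\mathcal{C}}$ is the family of all $(d+1)$-subsets of $[n]$ not in $\mathcal{C}$. $S=k[x_1,\ldots,x_n]$ with $k$ a field, $x_F=\prod_{i\in F}x_i$ for $F\subseteq[n]$, and $I(\mathcal{C})=\langle x_F: F\in\mathcal{C}\rangle\subseteq S$ (so $I(\emptyset)=0$). Chordality: a maximal subcircuit (MS) of $\mathcal{C}$ is a $d$-subset of $[n]$ contained in some circuit; $\mathcal{MS}(\mathcal{C})$ is the set of them. For $e\subseteq[n]$, $\mathcal{C}-e$ is the family of circuits of $\mathcal{C}$ that do not contain $e$. A set $L\subseteq[n]$ is a clique in $\mathcal{C}$ if every $(d+1)$-subset of $L$ is in $\mathcal{C}$. For an MS $e$, $\mathrm{N}[e]=e\cup\{v\in[n]: e\cup\{v\}\in\mathcal{C}\}$; $e$ is simplicial (an SMS) if $\mathrm{N}[e]$ is a clique in $\mathcal{C}$. The clutter $\mathcal{C}$ is chordal if it is empty or there is a sequence $e_1,\ldots,e_t$ such that $e_i$ is a simplicial maximal subcircuit of $\mathcal{C}-e_1-\cdots-e_{i-1}$ for each $i$ and $\mathcal{C}-e_1-\cdots-e_t=\emptyset$. For a monomial $u\neq 1$, $m(u)$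 is the largest $i$ with $x_i\mid u$. A squarefree monomial ideal $I$ is squarefree stable if for each squarefree monomial $u\in I$ and each $j<m(u)$ with $x_j\nmid u$, one has $x_ju/x_{m(u)}\in I$. *)

theory Defs
  imports "HOL-Library.Poly_Mapping" "HOL-Algebra.Ideal"
begin

section \<open>Clutters and chordality\<close>

text \<open>The ground set $[n]$ is \<open>{1..n}\<close>; a clutter is a family of sets of naturals.\<close>

definition all_circuits :: "nat \<Rightarrow> nat \<Rightarrow> nat set set" where
  "all_circuits n d = {F. F \<subseteq> {1..n} \<and> card F = d + 1}"

definition is_clutter :: "nat \<Rightarrow> nat \<Rightarrow> nat set set \<Rightarrow> bool" where
  "is_clutter n d C \<longleftrightarrow> C \<subseteq> all_circuits n d"

definition clutter_compl :: "nat \<Rightarrow> nat \<Rightarrow> nat set set \<Rightarrow> nat set set" where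
  "clutter_compl n d C = all_circuits n d - C"

definition max_subcircuits :: "nat \<Rightarrow> nat \<Rightarrow> nat set set \<Rightarrow> nat set set" where
  "max_subcircuits n d C = {e. e \<subseteq> {1..n} \<and> card e = d \<and> (\<exists>F\<in>C. e \<subseteq> F)}"

definition clutter_del :: "nat set set \<Rightarrow> nat set \<Rightarrow> nat set set" where
  "clutter_del C e = {F \<in> C. \<not> e \<subseteq> F}"

definition is_clique :: "nat \<Rightarrow> nat \<Rightarrow> nat set set \<Rightarrow> nat set \<Rightarrow> bool" where
  "is_clique n d C L \<longleftrightarrow> L \<subseteq> {1..n} \<and> (\<forall>F. F \<subseteq> L \<and> card F = d + 1 \<longrightarrow> F \<in> C)"

definition closed_nbhd :: "nat \<Rightarrow> nat set set \<Rightarrow> nat set \<Rightarrow> nat set" where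
  "closed_nbhd n C e = e \<union> {v \<in> {1..n}. e \<union> {v} \<in> C}"

definition is_SMS :: "nat \<Rightarrow> nat \<Rightarrow> nat set set \<Rightarrow> nat set \<Rightarrow> bool" where
  "is_SMS n d C e \<longleftrightarrow> e \<in> max_subcircuits n d C \<and> is_clique n d C (closed_nbhd n C e)"

text \<open>\<open>foldl clutter_del C (take i es)\<close> is the clutter left after deleting the first \<open>i\<close>
  entries of \<open>es\<close>; list positions start at 0.\<close>

definition chordal_clutter :: "nat \<Rightarrow> nat \<Rightarrow> nat set set \<Rightarrow> bool" where
  "chordal_clutter n d C \<longleftrightarrow>
     C = {} \<or>
     (\<exists>es. (\<forall>i < length es. is_SMS n d (foldl clutter_del C (take i es)) (es ! i)) \<and>
           foldl clutter_del C es = {})"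


section \<open>Squarefree monomial ideals\<close>

text \<open>Exponent vectors are finitely supported maps \<open>nat \<Rightarrow>\<^sub>0 nat\<close>, and a polynomial is a finitely
  supported map from exponent vectors to coefficients; multiplication is convolution. This type has
  infinitely many variables, so $S = k[x_1,\ldots,x_n]$ is the subring of those polynomials that
  involve the variables with index in \<open>{1..n}\<close> only, and ideals are taken in that subring.\<close>

type_synonym 'k mvpoly = "(nat \<Rightarrow>\<^sub>0 nat) \<Rightarrow>\<^sub>0 'k"

definition poly_ring_n :: "nat \<Rightarrow> ('k::field) mvpoly ring" where
  "poly_ring_n n = \<lparr>carrier = {p. \<forall>u \<in> Poly_Mapping.keys p. Poly_Mapping.keys u \<subseteq> {1..n}},
     monoid.mult = (*), one = 1, zero = 0, add = (+)\<rparr>"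

definition monomial_of :: "(nat \<Rightarrow>\<^sub>0 nat) \<Rightarrow> ('k::field) mvpoly" where
  "monomial_of u = Poly_Mapping.single u 1"

definition xvar :: "nat \<Rightarrow> ('k::field) mvpoly" where
  "xvar i = monomial_of (Poly_Mapping.single i 1)"

definition xF :: "nat set \<Rightarrow> ('k::field) mvpoly" where
  "xF F = (\<Prod>i\<in>F. xvar i)"

definition circuit_ideal :: "nat \<Rightarrow> nat set set \<Rightarrow> ('k::field) mvpoly set" where
  "circuit_ideal n C = genideal (poly_ring_n n) (xF ` C)"

definition sqfree_exp :: "nat \<Rightarrow> (nat \<Rightarrow>\<^sub>0 nat) \<Rightarrow> bool" where
  "sqfree_exp n u \<longleftrightarrow>
     Poly_Mapping.keys u \<subseteq> {1..n} \<and> (\<forall>i. Poly_Mapping.lookup u i \<le> 1)"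

definition sqfree_monomial_ideal :: "nat \<Rightarrow> ('k::field) mvpoly set \<Rightarrow> bool" where
  "sqfree_monomial_ideal n I \<longleftrightarrow>
     (\<exists>U. (\<forall>u\<in>U. sqfree_exp n u) \<and> I = genideal (poly_ring_n n) (monomial_of ` U))"

text \<open>The largest index of a variable dividing the monomial; meaningful for \<open>u \<noteq> 0\<close> only,
  that is, for monomials other than 1.\<close>

definition max_var :: "(nat \<Rightarrow>\<^sub>0 nat) \<Rightarrow> nat" where
  "max_var u = Max (Poly_Mapping.keys u)"

text \<open>The truncated subtraction below is exact, because \<open>max_var u\<close> lies in the support of \<open>u\<close>;
  the resulting exponent vector is that of $x_j u / x_{m(u)}$.\<close>

definition sqfree_stable :: "nat \<Rightarrow> ('k::field) mvpoly set \<Rightarrow> bool" where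
  "sqfree_stable n I \<longleftrightarrow>
     sqfree_monomial_ideal n I \<and>
     (\<forall>u j. sqfree_exp n u \<and> u \<noteq> 0 \<and> monomial_of u \<in> I \<and>
            1 \<le> j \<and> j < max_var u \<and> Poly_Mapping.lookup u j = 0 \<longrightarrow>
            monomial_of (u + Poly_Mapping.single j 1 - Poly_Mapping.single (max_var u) 1) \<in> I)"


section \<open>Basic facts\<close>

lemma cring_poly_ring_n: "cring (poly_ring_n n :: ('k::field) mvpoly ring)"
proof -
  let ?P = "{p :: 'k mvpoly. \<forall>u \<in> Poly_Mapping.keys p. Poly_Mapping.keys u \<subseteq> {1..n}}"
  have add: "p + q \<in> ?P" if "p \<in> ?P" "q \<in> ?P" for p q
    using that Poly_Mapping.keys_add[of p q] by blast
  have mult: "p * q \<in> ?P" if p: "p \<in> ?P" and q: "q \<in> ?P" for p q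
  proof (clarify)
    fix u i
    assume u: "u \<in> Poly_Mapping.keys (p * q)" and i: "i \<in> Poly_Mapping.keys u"
    obtain a b where "u = a + b" "a \<in> Poly_Mapping.keys p" "b \<in> Poly_Mapping.keys q"
      using u keys_mult[of p q] by blast
    moreover from this i have "i \<in> Poly_Mapping.keys a \<union> Poly_Mapping.keys b"
      using Poly_Mapping.keys_add[of a b] by blast
    ultimately show "i \<in> {1..n}" using p q by blast
  qed
  have neg: "\<exists>q\<in>?P. p + q = 0" if "p \<in> ?P" for p
    using that by (intro bexI[of _ "- p"]) auto
  have zo: "0 \<in> ?P" "1 \<in> ?P" by auto
  obtain P where P: "P = ?P" by simp
  have R: "poly_ring_n n = \<lparr>carrier = P, monoid.mult = (*), one = 1, zero = 0, add = (+)\<rparr>"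
    by (simp only: poly_ring_n_def P)
  note cl = add[folded P] mult[folded P] neg[folded P] zo[folded P]
  show ?thesis unfolding R
  proof (intro cringI)
    show "abelian_group \<lparr>carrier = P, monoid.mult = (*), one = 1, zero = 0, add = (+)\<rparr>"
      by (rule abelian_groupI) (simp_all add: cl add.assoc add.commute)
    show "Group.comm_monoid \<lparr>carrier = P, monoid.mult = (*), one = 1, zero = 0, add = (+)\<rparr>"
      by (rule comm_monoidI) (simp_all add: cl mult.assoc mult.commute)
  qed (simp add: distrib_right)
qed

lemma xF_eq_monomial_of:
  "xF F = (monomial_of (\<Sum>i\<in>F. Poly_Mapping.single i 1) :: ('k::field) mvpoly)"
proof (induction F rule: infinite_finite_induct)
  case (insert i F)
  then show ?case by (simp add: xF_def xvar_def monomial_of_def mult_single)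
qed (simp_all add: xF_def monomial_of_def)

lemma sqfree_exp_sum_single:
  assumes "F \<subseteq> {1..n}"
  shows "sqfree_exp n (\<Sum>i\<in>F. Poly_Mapping.single i 1)"
proof -
  have fin: "finite F" using assms finite_subset by blast
  have *: "Poly_Mapping.lookup (\<Sum>i\<in>F. Poly_Mapping.single i (1::nat)) j = (if j \<in> F then 1 else 0)"
    for j
    using fin by (induction F) (auto simp: lookup_add lookup_single when_def)
  show ?thesis
    using assms unfolding sqfree_exp_def
    by (auto simp: *[simplified] in_keys_iff split: if_splits)
qed

lemma sqfree_monomial_circuit_ideal:
  assumes "is_clutter n d C"
  shows "sqfree_monomial_ideal n (circuit_ideal n C :: ('k::field) mvpoly set)"
  unfolding sqfree_monomial_ideal_def circuit_ideal_def
proof (intro exI conjI ballI)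
  let ?U = "(\<lambda>F. \<Sum>i\<in>F. Poly_Mapping.single i (1::nat)) ` C"
  show "sqfree_exp n u" if "u \<in> ?U" for u
    using that assms sqfree_exp_sum_single
    by (auto simp: is_clutter_def all_circuits_def simp del: One_nat_def)
  have "xF ` C = (monomial_of ` ?U :: 'k mvpoly set)"
    by (simp add: image_image xF_eq_monomial_of)
  then show "genideal (poly_ring_n n) (xF ` C) =
      genideal (poly_ring_n n :: 'k mvpoly ring) (monomial_of ` ?U)" by simp
qed

end

theory Submission
  imports Defs
begin

text \<open>Restricted to monomials of degree \<open>d + 1\<close>, squarefree stability of the ideal of the complement
  says, by contraposition, that in a circuit any vertex may be exchanged for a vertex lying above the
  whole circuit. Let \<open>e\<close> be a maximal subcircuit with minimal vertex sum. Every \<open>v\<close> completing \<open>e\<close> to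
  a circuit lies above \<open>e\<close>, since otherwise exchanging some \<open>x > v\<close> of \<open>e\<close> for \<open>v\<close> would lower the
  sum. Hence every \<open>(d+1)\<close>-subset of \<open>N[e]\<close> arises from a circuit \<open>e \<union> {b}\<close> by upward exchanges, so
  \<open>e\<close> is simplicial. Deleting \<open>e\<close> preserves the exchange property, and one iterates.\<close>

definition upward_exchange :: "nat \<Rightarrow> nat set set \<Rightarrow> bool" where
  "upward_exchange n C \<longleftrightarrow>
     (\<forall>G\<in>C. \<forall>j\<in>G. \<forall>m\<in>{1..n}. (\<forall>x\<in>G. x < m) \<longrightarrow> insert m (G - {j}) \<in> C)"

section \<open>Supports of monomials in circuit ideals\<close>

lemma keys_sum_single:
  assumes "finite F"
  shows "Poly_Mapping.keys (\<Sum>i\<in>F. Poly_Mapping.single i (1::nat)) = F"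
proof -
  have "Poly_Mapping.lookup (\<Sum>i\<in>F. Poly_Mapping.single i (1::nat)) j = (if j \<in> F then 1 else 0)"
    for j
    using assms by (induction F) (auto simp: lookup_add lookup_single when_def)
  then show ?thesis by (auto simp: in_keys_iff split: if_splits)
qed

text \<open>Exponents are naturals, so supports only grow when monomials are multiplied; this gives
  absorption. The ideal serves to bound \<open>circuit_ideal n D\<close> from above,
  \<open>genideal\<close> being an intersection of ideals.\<close>

lemma ideal_supported:
  "ideal {p :: ('k::field) mvpoly. p \<in> carrier (poly_ring_n n) \<and>
            (\<forall>u \<in> Poly_Mapping.keys p. \<exists>F\<in>D. F \<subseteq> Poly_Mapping.keys u)} (poly_ring_n n)"
  (is "ideal ?J ?R")
proof -
  interpret R: cring ?R by (rule cring_poly_ring_n)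
  have add_R: "p \<oplus>\<^bsub>?R\<^esub> q = p + q" and mult_R: "p \<otimes>\<^bsub>?R\<^esub> q = p * q" and zero_R: "\<zero>\<^bsub>?R\<^esub> = 0"
    for p q :: "'k mvpoly"
    by (simp_all add: poly_ring_n_def)
  \<comment> \<open>The ring is a record with only an addition, so its additive inverse is
    identified with \<open>-\<close> by uniqueness.\<close>
  have uminus_R: "\<ominus>\<^bsub>?R\<^esub> p = - p" if "p \<in> carrier ?R" for p
  proof -
    have "- p \<in> carrier ?R" using that by (simp add: poly_ring_n_def)
    then show ?thesis using R.minus_equality[of "- p" p] that by (simp add: add_R zero_R)
  qed
  have absorb: "q * p \<in> ?J" if p: "p \<in> ?J" and q: "q \<in> carrier ?R" for p q
  proof -
    have "q * p \<in> carrier ?R" using R.m_closed[of q p] p q by (simp add: mult_R)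
    moreover have "\<exists>F\<in>D. F \<subseteq> Poly_Mapping.keys u" if u: "u \<in> Poly_Mapping.keys (q * p)" for u
    proof -
      obtain a b where ab: "u = a + b" "b \<in> Poly_Mapping.keys p"
        using u keys_mult[of q p] by blast
      then have "Poly_Mapping.keys b \<subseteq> Poly_Mapping.keys u"
        by (auto simp: in_keys_iff lookup_add)
      then show ?thesis using ab p by blast
    qed
    ultimately show ?thesis by blast
  qed
  show ?thesis
  proof (rule idealI)
    show "ring ?R" by (rule R.ring_axioms)
    have plus: "p + q \<in> ?J" if "p \<in> ?J" "q \<in> ?J" for p q
      using that R.a_closed[of p q] Poly_Mapping.keys_add[of p q] by (auto simp: add_R)
    have neg: "- p \<in> ?J" if "p \<in> ?J" for p
      using that by (auto simp: poly_ring_n_def)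
    show "subgroup ?J (add_monoid ?R)"
    proof (rule R.add.subgroupI)
      have "0 \<in> ?J" by (auto simp: poly_ring_n_def)
      then show "?J \<noteq> {}" by blast
      show "?J \<subseteq> carrier ?R" by blast
    next
      fix p assume p: "p \<in> ?J"
      then have "\<ominus>\<^bsub>?R\<^esub> p = - p" using uminus_R by blast
      then show "\<ominus>\<^bsub>?R\<^esub> p \<in> ?J" using neg[OF p] by (simp only:)
    next
      fix p q assume "p \<in> ?J" "q \<in> ?J"
      then show "p \<oplus>\<^bsub>?R\<^esub> q \<in> ?J" unfolding add_R by (rule plus)
    qed
  next
    fix p q assume p: "p \<in> ?J" and q: "q \<in> carrier ?R"
    show "q \<otimes>\<^bsub>?R\<^esub> p \<in> ?J" unfolding mult_R using p q by (rule absorb)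
    show "p \<otimes>\<^bsub>?R\<^esub> q \<in> ?J" unfolding mult_R mult.commute[of p q] using p q by (rule absorb)
  qed
qed

text \<open>The generators lie in the ideal of \<open>ideal_supported\<close>, hence so does
  \<open>monomial_of w\<close>, whose only exponent is \<open>w\<close>. This turns ideal membership
  into a containment of sets.\<close>

lemma monomial_in_circuit_ideal:
  assumes D: "D \<subseteq> all_circuits n d"
    and w: "(monomial_of w :: ('k::field) mvpoly) \<in> circuit_ideal n D"
  shows "\<exists>F\<in>D. F \<subseteq> Poly_Mapping.keys w"
proof -
  let ?J = "{p :: 'k mvpoly. p \<in> carrier (poly_ring_n n) \<and>
              (\<forall>u \<in> Poly_Mapping.keys p. \<exists>F\<in>D. F \<subseteq> Poly_Mapping.keys u)}"
  have "xF F \<in> ?J" if "F \<in> D" for F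
  proof -
    have F: "F \<subseteq> {1..n}" using that D by (auto simp: all_circuits_def)
    then have "finite F" using finite_subset by blast
    then show ?thesis
      using that F by (auto simp: xF_eq_monomial_of monomial_of_def poly_ring_n_def
          keys_sum_single[simplified])
  qed
  then have "circuit_ideal n D \<subseteq> ?J"
    using ideal_supported[of n D, where 'k='k] unfolding circuit_ideal_def genideal_def by blast
  then have "monomial_of w \<in> ?J" using w by blast
  then show ?thesis by (simp add: monomial_of_def)
qed

section \<open>From stability to exchanges of vertices\<close>

text \<open>Stability yields a monomial whose support lies in a set of \<open>d + 1\<close>
  elements; the member of \<open>D\<close> found inside that support has the same size and so fills
  the set.\<close>

lemma sqfree_stable_exchange:
  assumes D: "D \<subseteq> all_circuits n d"
    and stable: "sqfree_stable n (circuit_ideal n D :: ('k::field) mvpoly set)"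
    and F: "F \<in> D" and j: "1 \<le> j" "j < Max F" "j \<notin> F"
  shows "insert j (F - {Max F}) \<in> D"
proof -
  define u where "u = (\<Sum>i\<in>F. Poly_Mapping.single i (1::nat))"
  have Fn: "F \<subseteq> {1..n}" and cF: "card F = d + 1" using D F by (auto simp: all_circuits_def)
  have fin: "finite F" using Fn finite_subset by blast
  have ne: "F \<noteq> {}" using cF by auto
  have keys: "Poly_Mapping.keys u = F" using fin unfolding u_def by (rule keys_sum_single)
  have sq: "sqfree_exp n u" unfolding u_def by (rule sqfree_exp_sum_single[OF Fn])
  have mv: "max_var u = Max F" by (simp add: max_var_def keys)
  have "xF F \<in> (circuit_ideal n D :: 'k mvpoly set)"
    using F unfolding circuit_ideal_def genideal_def by blast
  then have "(monomial_of u :: 'k mvpoly) \<in> circuit_ideal n D"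
    by (simp only: u_def xF_eq_monomial_of)
  moreover have "u \<noteq> 0" using keys ne by auto
  moreover have "Poly_Mapping.lookup u j = 0" using j(3) keys by (auto simp: in_keys_iff)
  ultimately have
    "(monomial_of (u + Poly_Mapping.single j 1 - Poly_Mapping.single (Max F) 1) :: 'k mvpoly)
       \<in> circuit_ideal n D"
    using stable sq j mv unfolding sqfree_stable_def by metis
  then obtain F' where F': "F' \<in> D"
    and sub: "F' \<subseteq> Poly_Mapping.keys (u + Poly_Mapping.single j 1 - Poly_Mapping.single (Max F) 1)"
    using monomial_in_circuit_ideal[OF D] by blast
  \<comment> \<open>Exponents of \<open>u\<close> are at most 1, so a single subtraction removes
    \<open>Max F\<close> from the support.\<close>
  have "Poly_Mapping.lookup u i \<le> 1" for i using sq by (simp add: sqfree_exp_def)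
  then have "Poly_Mapping.keys (u + Poly_Mapping.single j 1 - Poly_Mapping.single (Max F) 1)
      \<subseteq> insert j (F - {Max F})"
    using j keys by (auto simp: in_keys_iff lookup_add lookup_minus lookup_single when_def
        split: if_splits)
  with sub have "F' \<subseteq> insert j (F - {Max F})" by blast
  moreover have "card (insert j (F - {Max F})) = d + 1"
    using fin ne j cF Max_in[OF fin ne] by (simp add: card_Diff_singleton)
  moreover have "card F' = d + 1" using D F' by (auto simp: all_circuits_def)
  ultimately have "F' = insert j (F - {Max F})"
    using fin by (intro card_subset_eq) auto
  then show ?thesis using F' by simp
qed

text \<open>If the exchanged set were in the complement, its maximum would be \<open>m\<close>, and
  stability, replacing \<open>m\<close> by the smaller \<open>j\<close>, would put \<open>G\<close>
  in the complement as well.\<close>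

lemma upward_exchange_of_sqfree_stable:
  assumes C: "is_clutter n d C"
    and stable: "sqfree_stable n (circuit_ideal n (clutter_compl n d C) :: ('k::field) mvpoly set)"
  shows "upward_exchange n C"
  unfolding upward_exchange_def
proof (intro ballI impI, rule ccontr)
  fix G j m
  assume G: "G \<in> C" and j: "j \<in> G" and m: "m \<in> {1..n}" and above: "\<forall>x\<in>G. x < m"
    and notin: "insert m (G - {j}) \<notin> C"
  let ?F = "insert m (G - {j})"
  have Gn: "G \<subseteq> {1..n}" and cG: "card G = d + 1"
    using C G by (auto simp: is_clutter_def all_circuits_def)
  have fin: "finite G" using Gn finite_subset by blast
  have mG: "m \<notin> G" using above by blast
  have "card ?F = d + 1" using fin mG cG j by (simp add: card_Diff_singleton)
  then have F: "?F \<in> clutter_compl n d C"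
    using Gn m notin by (auto simp: clutter_compl_def all_circuits_def)
  have "Max ?F = m" using fin above by (intro Max_eqI) (auto intro: less_imp_le)
  moreover have "insert j (?F - {m}) = G" using j mG by blast
  moreover have "1 \<le> j" "j < m" "j \<notin> ?F" using Gn j above by auto
  moreover have "clutter_compl n d C \<subseteq> all_circuits n d" by (auto simp: clutter_compl_def)
  ultimately have "G \<in> clutter_compl n d C"
    using sqfree_stable_exchange[OF _ stable F] by metis
  then show False using G by (simp add: clutter_compl_def)
qed

section \<open>Circuits reached by upward exchanges\<close>

text \<open>Each step trades a vertex of \<open>G - H\<close> for the least vertex of
  \<open>H - G\<close>. Choosing the least one keeps the remaining vertices of \<open>H - G\<close>
  above the new circuit, so the induction continues.\<close>

lemma upward_exchange_mem:
  assumes ex: "upward_exchange n C"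
    and "G \<in> C" "finite G" "finite H" "H \<subseteq> {1..n}" "card H = card G"
    and "\<forall>x\<in>H - G. \<forall>y\<in>G. y < x"
  shows "H \<in> C"
  using assms(2-)
proof (induction "card (H - G)" arbitrary: G)
  case 0
  then have "H \<subseteq> G" by simp
  then show ?case using 0 card_subset_eq by metis
next
  case (Suc k)
  define m where "m = Min (H - G)"
  have fin: "finite (H - G)" using Suc.prems by simp
  have ne: "H - G \<noteq> {}" using Suc.hyps(2) by (metis card.empty nat.distinct(1))
  have m: "m \<in> H - G" and least: "\<forall>x\<in>H - G. m \<le> x"
    using fin ne by (auto simp: m_def intro: Min_in simp del: Diff_iff)
  have "\<not> G \<subseteq> H" using Suc.prems ne card_subset_eq[of H G] by auto
  then obtain j where j: "j \<in> G" "j \<notin> H" by blast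
  let ?G = "insert m (G - {j})"
  have diff: "H - ?G = H - G - {m}" using j by blast
  have k: "k = card (H - ?G)" using Suc.hyps(2) fin m by (simp only: diff) simp
  have G: "?G \<in> C" using ex Suc.prems j m unfolding upward_exchange_def by blast
  have card: "card H = card ?G"
    using Suc.prems j m by (simp add: card_Diff_singleton) (metis Suc_pred card_gt_0_iff empty_iff)
  have above: "\<forall>x\<in>H - ?G. \<forall>y\<in>?G. y < x"
  proof (intro ballI)
    fix x y assume x: "x \<in> H - ?G" and y: "y \<in> ?G"
    have xH: "x \<in> H - G" "x \<noteq> m" using x diff by auto
    then have "m < x" using least by (metis le_neq_implies_less)
    then show "y < x" using xH y Suc.prems by blast
  qed
  have "finite ?G" using Suc.prems by simp
  from Suc.hyps(1)[OF k G this _ _ card above] Suc.prems show ?case by blast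
qed

section \<open>Simplicial subcircuits and their deletion\<close>

lemma exists_lower_max_subcircuit:
  assumes C: "is_clutter n d C" and "C \<noteq> {}"
  shows "\<exists>e\<in>max_subcircuits n d C. \<forall>v. insert v e \<in> C \<and> v \<notin> e \<longrightarrow> (\<forall>x\<in>e. x < v)"
proof -
  obtain F where F: "F \<in> C" using assms by blast
  then have Fn: "F \<subseteq> {1..n}" "card F = d + 1" using C by (auto simp: is_clutter_def all_circuits_def)
  obtain e0 where "e0 \<subseteq> F" "card e0 = d"
    using obtain_subset_with_card_n[of d F] Fn by auto
  then have "e0 \<in> max_subcircuits n d C" using F Fn by (auto simp: max_subcircuits_def)
  then obtain e where e: "e \<in> max_subcircuits n d C"
    and least: "\<And>e'. e' \<in> max_subcircuits n d C \<Longrightarrow> \<Sum>e \<le> \<Sum>e'"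
    using ex_has_least_nat[of "\<lambda>e. e \<in> max_subcircuits n d C" e0 "\<Sum>"] by blast
  have en: "e \<subseteq> {1..n}" "card e = d" using e by (auto simp: max_subcircuits_def)
  have fin: "finite e" using en finite_subset by blast
  have "x < v" if v: "insert v e \<in> C" "v \<notin> e" and x: "x \<in> e" for v x
  proof (rule ccontr)
    assume "\<not> x < v"
    moreover have "x \<noteq> v" using x v by blast
    ultimately have less: "v < x" by simp
    \<comment> \<open>\<open>?e\<close> lies in the same circuit \<open>insert v e\<close> as
      \<open>e\<close>, so it competes with \<open>e\<close> for the least sum.\<close>
    let ?e = "insert v (e - {x})"
    have "insert v e \<subseteq> {1..n}" using v C by (auto simp: is_clutter_def all_circuits_def)
    then have sub: "?e \<subseteq> {1..n}" by blast
    have "card ?e = card e" using fin v x by (metis Diff_iff card_Suc_Diff1 card_insert_disjoint finite_Diff)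
    moreover have "?e \<subseteq> insert v e" by blast
    ultimately have "?e \<in> max_subcircuits n d C"
      using sub en v unfolding max_subcircuits_def by blast
    then have "\<Sum>e \<le> \<Sum>?e" by (rule least)
    moreover have "\<Sum>?e = v + \<Sum>(e - {x})" using fin v by simp
    moreover have "\<Sum>e = x + \<Sum>(e - {x})" using fin x by (rule sum.remove)
    ultimately show False using less by simp
  qed
  then show ?thesis using e by blast
qed

lemma upward_exchange_SMS:
  assumes C: "is_clutter n d C" and ex: "upward_exchange n C"
    and e: "e \<in> max_subcircuits n d C"
    and above: "\<And>v x. insert v e \<in> C \<Longrightarrow> v \<notin> e \<Longrightarrow> x \<in> e \<Longrightarrow> x < v"
  shows "is_SMS n d C e"
  unfolding is_SMS_def is_clique_def
proof (intro conjI allI impI e)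
  have en: "e \<subseteq> {1..n}" "card e = d" using e by (auto simp: max_subcircuits_def)
  then have fin: "finite e" using finite_subset by blast
  show nb: "closed_nbhd n C e \<subseteq> {1..n}" using en by (auto simp: closed_nbhd_def)
  fix H assume H: "H \<subseteq> closed_nbhd n C e \<and> card H = d + 1"
  then have Hn: "H \<subseteq> {1..n}" using nb by blast
  then have finH: "finite H" using finite_subset by blast
  \<comment> \<open>The exchanges start from the circuit \<open>insert b e\<close>: the other
    vertices of \<open>H\<close> outside \<open>e\<close> exceed \<open>b\<close> by minimality and
    \<open>e\<close> by \<open>above\<close>.\<close>
  define b where "b = Min (H - e)"
  have "\<not> H \<subseteq> e" using H en fin card_mono[of e H] by auto
  then have ne: "H - e \<noteq> {}" by blast
  have b: "b \<in> H - e" and least: "\<forall>x\<in>H - e. b \<le> x"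
    using finH ne by (auto simp: b_def intro: Min_in simp del: Diff_iff)
  have nbr: "insert v e \<in> C" if "v \<in> H - e" for v
    using that H by (auto simp: closed_nbhd_def)
  show "H \<in> C"
  proof (rule upward_exchange_mem[OF ex nbr[OF b] _ finH Hn])
    show "finite (insert b e)" using fin by simp
    show "card H = card (insert b e)" using fin b en H by simp
    show "\<forall>x\<in>H - insert b e. \<forall>y\<in>insert b e. y < x"
    proof (intro ballI)
      fix x y assume x: "x \<in> H - insert b e" and y: "y \<in> insert b e"
      have "b < x" using x least by (auto intro: le_neq_implies_less)
      moreover have "y < x" if "y \<in> e" using above[OF nbr[of x]] x that by blast
      ultimately show "y < x" using y by blast
    qed
  qed
qed

text \<open>If an exchange in \<open>C - e\<close> produced a circuit containing \<open>e\<close>, the vertex outside \<open>e\<close> would be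
  the new vertex \<open>m\<close>, so the circuit one started from would already contain \<open>e\<close>.\<close>

lemma upward_exchange_del:
  assumes C: "is_clutter n d C" and ex: "upward_exchange n C"
    and e: "e \<in> max_subcircuits n d C"
    and above: "\<And>v x. insert v e \<in> C \<Longrightarrow> v \<notin> e \<Longrightarrow> x \<in> e \<Longrightarrow> x < v"
  shows "upward_exchange n (clutter_del C e)"
  unfolding upward_exchange_def
proof (intro ballI impI)
  fix G j m
  assume G: "G \<in> clutter_del C e" and j: "j \<in> G" and m: "m \<in> {1..n}" and up: "\<forall>x\<in>G. x < m"
  let ?H = "insert m (G - {j})"
  have GC: "G \<in> C" and Ge: "\<not> e \<subseteq> G" using G by (auto simp: clutter_del_def)
  have H: "?H \<in> C" using ex GC j m up unfolding upward_exchange_def by blast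
  have "\<not> e \<subseteq> ?H"
  proof
    assume sub: "e \<subseteq> ?H"
    have cH: "card ?H = d + 1"
      using H C by (auto simp: is_clutter_def all_circuits_def)
    then have finH: "finite ?H" by (metis Suc_eq_plus1 card.infinite nat.distinct(1))
    have ce: "card e = d" using e by (simp add: max_subcircuits_def)
    have fe: "finite e" using sub finH by (rule finite_subset)
    have "card (?H - e) = 1" using card_Diff_subset[OF fe sub] cH ce by simp
    then obtain v where v: "?H - e = {v}" by (auto simp: card_1_singleton_iff)
    then have He: "?H = insert v e" "v \<notin> e" using sub by blast+
    \<comment> \<open>Only \<open>m\<close> can be new in \<open>?H\<close>, so \<open>e\<close>
      must use it; then \<open>v\<close> comes from \<open>G\<close> and lies below
      \<open>m\<close>, against \<open>above\<close>.\<close>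
    have me: "m \<in> e" using sub Ge by blast
    have "v \<in> ?H" "v \<noteq> m" using v me by auto
    then have "v \<in> G" by blast
    then have "v < m" using up by blast
    moreover have "m < v" using above[of v m] H He me by simp
    ultimately show False by simp
  qed
  then show "?H \<in> clutter_del C e" using H by (simp add: clutter_del_def)
qed

section \<open>Building the elimination sequence\<close>

text \<open>Putting \<open>e\<close> in front of a sequence for \<open>clutter_del C e\<close>
  shifts every position by one, and position 0 is the hypothesis on \<open>e\<close>.\<close>

lemma chordal_clutter_step:
  assumes e: "is_SMS n d C e" and rest: "chordal_clutter n d (clutter_del C e)"
  shows "chordal_clutter n d C"
proof -
  obtain es where es: "\<And>i. i < length es \<Longrightarrow>
        is_SMS n d (foldl clutter_del (clutter_del C e) (take i es)) (es ! i)"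
    and end_es: "foldl clutter_del (clutter_del C e) es = {}"
  \<comment> \<open>The empty case of \<open>chordal_clutter\<close> supplies no sequence, so
    \<open>[]\<close> is given there.\<close>
  proof (cases "clutter_del C e = {}")
    case True
    then show ?thesis using that[of "[]"] by simp
  next
    case False
    then show ?thesis using that rest unfolding chordal_clutter_def by blast
  qed
  have "is_SMS n d (foldl clutter_del C (take i (e # es))) ((e # es) ! i)"
    if "i < length (e # es)" for i
    using that e es by (cases i) auto
  then show ?thesis using end_es unfolding chordal_clutter_def by (intro disjI2 exI[of _ "e # es"]) auto
qed

lemma upward_exchange_chordal:
  assumes "is_clutter n d C" "upward_exchange n C"
  shows "chordal_clutter n d C"
  using assms
proof (induction "card C" arbitrary: C rule: less_induct)
  case less
  show ?case
  proof (cases "C = {}")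
    case True
    then show ?thesis by (simp add: chordal_clutter_def)
  next
    case False
    then obtain e where e: "e \<in> max_subcircuits n d C"
      and above: "\<And>v x. insert v e \<in> C \<Longrightarrow> v \<notin> e \<Longrightarrow> x \<in> e \<Longrightarrow> x < v"
      using exists_lower_max_subcircuit[OF less.prems(1)] by blast
    have "C \<subseteq> Pow {1..n}" using less.prems by (auto simp: is_clutter_def all_circuits_def)
    then have "finite C" using finite_subset by blast
    \<comment> \<open>Strict, because a maximal subcircuit lies in some circuit, which the deletion
      removes.\<close>
    moreover have "clutter_del C e \<subset> C"
      using e by (auto simp: clutter_del_def max_subcircuits_def)
    ultimately have smaller: "card (clutter_del C e) < card C" by (rule psubset_card_mono)
    have "is_clutter n d (clutter_del C e)"
      using less.prems by (auto simp: is_clutter_def clutter_del_def)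
    moreover have "upward_exchange n (clutter_del C e)"
      using less.prems e above by (rule upward_exchange_del)
    ultimately have "chordal_clutter n d (clutter_del C e)" by (rule less.hyps[OF smaller])
    moreover have "is_SMS n d C e" using less.prems e above by (rule upward_exchange_SMS)
    ultimately show ?thesis by (rule chordal_clutter_step[rotated])
  qed
qed

theorem theorem2p5:
  fixes n d :: nat and C :: "nat set set"
  assumes "is_clutter n d C"
    and "sqfree_stable n (circuit_ideal n (clutter_compl n d C) :: ('k::field) mvpoly set)"
  shows "chordal_clutter n d C"
  using assms(1) upward_exchange_of_sqfree_stable[OF assms] by (rule upward_exchange_chordal)

end
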